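(* Let $\alpha\neq 0,\beta,\gamma$ be constants and let $(\delta_n)_{n\in\mathbb{N}}$ be a sequence of constants such that the quantity $$n+\frac{-\beta\gamma+\alpha(\delta_n-\alpha)}{\alpha^2}$$ is equal to a constant $c$ independent of $n$. Put $A(x)=\alpha x+\beta$ and $B(x)=\gamma x+\delta_n$, and let $$\sigma(x)=(\alpha x+\beta)^{c}\exp\left(\frac{\gamma}{\alpha}x\right).$$ Let $e_n$ ($n\in\mathbb{N}$) be the hypergeometric polynomials, solutions of $A y''+B y'+\lambda_n y=0$ with $\lambda_n=-nB'-\frac{n(n-1)}{2}A''=-n\gamma$, given by $$e_n(x)=\frac{n!}{2\pi i}\,\frac{A^n(x)}{\sigma(x)}\int_{(C)}\frac{\sigma(s)}{(s-x)^{n+1}}\,ds ,$$ where $A(x)\neq 0$ and $(C)$ is a closed contour surrounding $x$ once positively such that $\sigma$ is analytic on and inside $(C)$. Then their generating function $$E(x,t)=\sum_{n=0}^{+\infty}\frac{1}{n!}\,e_n(x)\,t^n$$ is given, for $|t|$ sufficiently small (depending on $x$), by $$E(x,t)=\frac{\sigma(s)}{\sigma(x)}\bigg|_{s=\xi(x,t)},$$ where $s=\xi(x,t)$ is the solution of $s-x-A(x)t=0$.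
   Context: For the equation $Ay''+By'+\lambda_n y=0$, let $\rho$ be a solution of $(A\rho)'=B\rho$ (so $\rho$ depends on $n$ through $\delta_n$) and put $\rho_n=A^n\rho$. One can take $\rho(x)=(\alpha x+\beta)^{(-\beta\gamma+\alpha(\delta_n-\alpha))/\alpha^2}\exp(\gamma x/\alpha)$. The hypothesis says precisely that $\rho_n$ does not depend on $n$, and then $\sigma:=\rho_n$. When $c$ is not an integer, $(\alpha x+\beta)^c$ denotes a fixed branch analytic on and inside $(C)$, the same branch being used for $\sigma(s)$ and $\sigma(x)$. A prime denotes differentiation with respect to $x$. *)

theory Defs
  imports "HOL-Complex_Analysis.Complex_Analysis"
begin

definition hypergeometric_ode ::
  "complex poly \<Rightarrow> complex poly \<Rightarrow> complex \<Rightarrow> complex poly \<Rightarrow> bool"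
  where "hypergeometric_ode A B lam y \<longleftrightarrow>
    A * pderiv (pderiv y) + B * pderiv y + smult lam y = 0"

text \<open>
  \<open>analytic_power_branch f c S p\<close>: \<open>p\<close> is an analytic branch of the multivalued function
  \<open>f(z)\<^sup>c\<close> on \<open>S\<close>. Each value is one of the values \<open>exp (c * log (f z))\<close>. There are only
  countably many of those, with ratios \<open>exp (2 * pi * i * c * k)\<close>, so on a connected set
  analyticity forces a single coherent branch. Zeros of \<open>f\<close> are exempt from the pointwise
  condition so that \<open>S\<close> may contain them when \<open>c\<close> is a nonnegative integer; the value of \<open>p\<close>
  there is determined by continuity.
\<close>

definition analytic_power_branch ::
  "(complex \<Rightarrow> complex) \<Rightarrow> complex \<Rightarrow> complex set \<Rightarrow> (complex \<Rightarrow> complex) \<Rightarrow> bool"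
  where "analytic_power_branch f c S p \<longleftrightarrow>
    p analytic_on S \<and>
    (\<forall>z\<in>S. f z \<noteq> 0 \<longrightarrow> (\<exists>l. exp l = f z \<and> p z = exp (c * l)))"

text \<open>For an integer exponent the only branch is the ordinary power.\<close>

lemma analytic_power_branch_of_int:
  assumes "analytic_power_branch f (of_int k) S p" "z \<in> S" "f z \<noteq> 0"
  shows "p z = f z powi k"
proof -
  obtain l where "exp l = f z" "p z = exp (of_int k * l)"
    using assms by (auto simp: analytic_power_branch_def)
  then show ?thesis
    by (metis exp_power_int)
qed

text \<open>
  A closed contour with winding number 1 around \<open>x\<close>; it need not be simple.
\<close>

definition surrounds_once_positively :: "(real \<Rightarrow> complex) \<Rightarrow> complex \<Rightarrow> bool"
  where "surrounds_once_positively C x \<longleftrightarrow>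
    valid_path C \<and> pathfinish C = pathstart C \<and>
    x \<notin> path_image C \<and> winding_number C x = 1"

definition on_and_inside :: "(real \<Rightarrow> complex) \<Rightarrow> complex set"
  where "on_and_inside C = path_image C \<union> inside (path_image C)"

definition \<xi> :: "(complex \<Rightarrow> complex) \<Rightarrow> complex \<Rightarrow> complex \<Rightarrow> complex"
  where "\<xi> A x t = (THE s. s - x - A x * t = 0)"

end

theory Submission
  imports Defs
begin

text \<open>
  By Cauchy's formula for derivatives, the contour integral formula for \<open>e\<^sub>n\<close> is Rodrigues' formula
  \<open>e\<^sub>n(x) = A(x)\<^sup>n \<sigma>\<^sup>(\<^sup>n\<^sup>)(x) / \<sigma>(x)\<close>. Hence \<open>E(x,t)\<close> is the Taylor series of \<open>\<sigma>\<close> at \<open>x\<close>,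
  evaluated at \<open>x + A(x) t = \<xi>(x,t)\<close> and divided by \<open>\<sigma>(x)\<close>.
\<close>

text \<open>The winding number vanishes on the outside, whose complement is
  \<open>on_and_inside C\<close>; \<open>C\<close> may cross itself.\<close>

lemma winding_number_nonzero_imp_on_and_inside:
  assumes "path C" "pathfinish C = pathstart C" "winding_number C z \<noteq> 0"
  shows "z \<in> on_and_inside C"
  using assms winding_number_zero_in_outside[of C z]
  by (auto simp: on_and_inside_def inside_outside)

text \<open>The residue theorem applies with \<open>x\<close> as the only possible singularity,
  where the winding number is 1.\<close>

lemma contour_integral_Cauchy_higher_derivative:
  assumes once: "surrounds_once_positively C x" and f: "f analytic_on on_and_inside C"
  shows "contour_integral C (\<lambda>s. f s / (s - x) ^ Suc n) =
           2 * of_real pi * \<i> * (deriv ^^ n) f x / fact n"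
proof -
  have C: "valid_path C" "pathfinish C = pathstart C" "x \<notin> path_image C" "winding_number C x = 1"
    using once by (auto simp: surrounds_once_positively_def)
  let ?K = "on_and_inside C"
  have K: "z \<in> ?K" if "winding_number C z \<noteq> 0" for z
    using that C by (intro winding_number_nonzero_imp_on_and_inside valid_path_imp_path)
  have "connected ?K"
    unfolding on_and_inside_def using C(1)
    by (intro connected_with_inside closed_path_image connected_path_image valid_path_imp_path)
  obtain S where S: "open S" "?K \<subseteq> S" "f holomorphic_on S"
    using f by (auto simp: analytic_on_holomorphic)
  \<comment> \<open>The residue theorem wants a connected open domain, but \<open>S\<close> may be
    disconnected. As \<open>?K\<close> is connected and contains \<open>x\<close>, the component of
    \<open>x\<close> still contains all of \<open>?K\<close>.\<close>
  let ?U = "connected_component_set S x"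
  have x: "x \<in> ?K" by (simp add: K C)
  have KU: "?K \<subseteq> ?U"
    using S(2) x \<open>connected ?K\<close> by (intro connected_component_maximal)
  have U: "open ?U" "connected ?U" "f holomorphic_on ?U" "x \<in> ?U"
    using S connected_component_subset[of S x] KU x
    by (auto intro: open_connected_component holomorphic_on_subset)
  have "contour_integral C (\<lambda>s. f s / (s - x) ^ Suc n) =
      2 * pi * \<i> * (\<Sum>p\<in>{x}. winding_number C p * residue (\<lambda>s. f s / (s - x) ^ Suc n) p)"
  proof (rule Residue_theorem)
    show "(\<lambda>s. f s / (s - x) ^ Suc n) holomorphic_on ?U - {x}"
      using U(3) by (intro holomorphic_intros) (auto intro: holomorphic_on_subset)
    show "path_image C \<subseteq> ?U - {x}"
      using KU C(3) by (auto simp: on_and_inside_def)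
    show "\<forall>z. z \<notin> ?U \<longrightarrow> winding_number C z = 0"
      using K KU by blast
  qed (use U C in auto)
  \<comment> \<open>The residue at \<open>x\<close> is the Taylor coefficient of \<open>f\<close> of
    order \<open>n\<close>.\<close>
  then show ?thesis
    using C(4) residue_holomorphic_over_power[OF U(1) U(4) U(3), of n] by simp
qed

theorem theorem2:
  fixes \<alpha> \<beta> \<gamma> c x :: complex
    and \<delta> :: "nat \<Rightarrow> complex"
    and A p \<sigma> :: "complex \<Rightarrow> complex"
    and e :: "nat \<Rightarrow> complex poly"
    and C :: "real \<Rightarrow> complex"
  assumes "\<alpha> \<noteq> 0"
    and "\<And>n. of_nat n + (- \<beta> * \<gamma> + \<alpha> * (\<delta> n - \<alpha>)) / \<alpha>\<^sup>2 = c"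
    and "\<And>z. A z = \<alpha> * z + \<beta>"
    and "\<And>z. \<sigma> z = p z * exp (\<gamma> / \<alpha> * z)"
    and "A x \<noteq> 0"
    and "surrounds_once_positively C x"
    and "analytic_power_branch A c (on_and_inside C) p"
    and "\<And>n. hypergeometric_ode [:\<beta>, \<alpha>:] [:\<delta> n, \<gamma>:] (- of_nat n * \<gamma>) (e n)"
    and "\<And>n. poly (e n) x =
           fact n / (2 * of_real pi * \<i>) * (A x ^ n / \<sigma> x) *
             contour_integral C (\<lambda>s. \<sigma> s / (s - x) ^ (n + 1))"
  shows "\<exists>r>0. \<forall>t. norm t < r \<longrightarrow>
           (\<lambda>n. 1 / fact n * poly (e n) x * t ^ n) sums (\<sigma> (\<xi> A x t) / \<sigma> x)"
proof -
  have "\<sigma> = (\<lambda>z. p z * exp (\<gamma> / \<alpha> * z))"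
    using assms(4) by blast
  moreover have "p analytic_on on_and_inside C"
    using assms(7) by (simp add: analytic_power_branch_def)
  ultimately have an: "\<sigma> analytic_on on_and_inside C"
    by (auto intro!: analytic_intros simp: assms(1))
  have "x \<in> on_and_inside C"
    using assms(6)
    by (auto simp: surrounds_once_positively_def
        intro: winding_number_nonzero_imp_on_and_inside valid_path_imp_path)
  then obtain R where R: "R > 0" "\<sigma> holomorphic_on ball x R"
    using an by (auto simp: analytic_on_def)
  \<comment> \<open>The factor \<open>A x ^ n * t ^ n\<close> is written as a power of the
    displacement from \<open>x\<close>, the form of a Taylor term at
    \<open>x + A x * t\<close>.\<close>
  have coeff: "1 / fact n * poly (e n) x * t ^ n =
      (deriv ^^ n) \<sigma> x / fact n * (x + A x * t - x) ^ n / \<sigma> x" for n t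
    unfolding assms(9) contour_integral_Cauchy_higher_derivative[OF assms(6) an]
      Suc_eq_plus1[symmetric]
    by (simp add: power_mult_distrib)
  \<comment> \<open>\<open>A\<close> is evaluated at \<open>x\<close>, not at \<open>s\<close>, so
    the equation is linear in \<open>s\<close> with a unique root.\<close>
  have \<xi>: "\<xi> A x t = x + A x * t" for t
    unfolding \<xi>_def by (rule the_equality) (auto simp: algebra_simps)
  show ?thesis
  proof (intro exI conjI allI impI)
    \<comment> \<open>This radius keeps \<open>x + A x * t\<close> in the ball where
      \<open>\<sigma>\<close> is holomorphic.\<close>
    show "R / norm (A x) > 0"
      using R(1) assms(5) by simp
    fix t :: complex
    assume "norm t < R / norm (A x)"
    then have "x + A x * t \<in> ball x R"
      using assms(5) by (simp add: dist_norm norm_mult field_simps)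
    then show "(\<lambda>n. 1 / fact n * poly (e n) x * t ^ n) sums (\<sigma> (\<xi> A x t) / \<sigma> x)"
      unfolding coeff \<xi> by (intro sums_divide holomorphic_power_series[OF R(2)])
  qed
qed

end
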